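(* For each $j\in[m]$, let $\Lambda_j=\{\Lambda_{ij}\}_{i\in I}$ be a g-frame for $\mathcal H$ with frame bounds $A_j$ and $B_j$. Let $\lambda_j,\eta_j,\mu_j\ge0$, $j\in[m-1]$, be such that $$A=A_1-\sum_{j\in[m-1]}(\lambda_j+\eta_j\sqrt{B_j}+\mu_j\sqrt{B_{j+1}})(\sqrt{B_j}+\sqrt{B_{j+1}})>0$$ and $$\Big\|\sum_{i\in J}(\Lambda_{ij}^*-\Lambda_{i(j+1)}^* )g_i\Big\|\le\eta_j\Big\|\sum_{i\in J}\Lambda_{ij}^*g_i\Big\|+\mu_j\Big\|\sum_{i\in J}\Lambda_{i(j+1)}^*g_i\Big\|+\lambda_j\Big(\sum_{i\in J}\|g_i\|^2\Big)^{1/2}$$ for any finite subset $J\subset I$, any $g_i\in\mathcal H_i$ $(i\in J)$ and any $j\in[m-1]$. Then for any partition $\{\sigma_j\}_{j\in[m]}$ of $I$, the family $\{\Lambda_{ij}\}_{i\in\sigma_j,\,j\in[m]}$ is a g-frame for $\mathcal H$ with universal lower and upper frame bounds $A$ and $\sum_{j\in[m]}B_j$.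
   Context: $\mathcal H$ and $\mathcal K$ are Hilbert spaces, $I\subset\mathbb N$, $\{\mathcal H_i\}_{i\in I}$ is a sequence of closed subspaces of $\mathcal K$, $\Lambda_{ij}\in L(\mathcal H,\mathcal H_i)$ are bounded linear operators, and $[m]=\{1,\dots,m\}$. A family of operators is a g-frame for $\mathcal H$ with bounds $A,B$ if $A,B>0$ are constants such that, for all $f\in\mathcal H$, the sum of $\|\Lambda f\|^2$ over the members $\Lambda$ of the family lies between $A\|f\|^2$ and $B\|f\|^2$. A partition $\{\sigma_j\}_{j\in[m]}$ of $I$ is a family of pairwise disjoint (possibly empty) subsets whose union is $I$. "Universal" bounds are bounds valid simultaneously for all partitions. *)

theory Defs
  imports "HOL-Analysis.Analysis"
begin

text \<open>
  Hilbert spaces over a scalar field \<open>S\<close> that is either \<open>\<real>\<close> or \<open>\<complex>\<close>, treated uniformly: scalars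
  are complex numbers, only \<open>smul c\<close> with \<open>c \<in> S\<close> is constrained, and \<open>ip\<close> takes values in \<open>S\<close>.
  The type class supplies the vector addition, the restriction of the scalars to the reals,
  the norm, and completeness; the last axiom says that the norm is the one induced by \<open>ip\<close>.
  The inner product is linear in its first argument.
\<close>

locale hilbert_space =
  fixes S :: "complex set"
    and smul :: "complex \<Rightarrow> 'v::banach \<Rightarrow> 'v"
    and ip :: "'v \<Rightarrow> 'v \<Rightarrow> complex"
  assumes scalars: "S = \<real> \<or> S = UNIV"
    and smul_of_real: "smul (of_real r) x = r *\<^sub>R x"
    and smul_add_left: "\<lbrakk>a \<in> S; b \<in> S\<rbrakk> \<Longrightarrow> smul (a + b) x = smul a x + smul b x"
    and smul_add_right: "a \<in> S \<Longrightarrow> smul a (x + y) = smul a x + smul a y"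
    and smul_mult: "\<lbrakk>a \<in> S; b \<in> S\<rbrakk> \<Longrightarrow> smul (a * b) x = smul a (smul b x)"
    and ip_in_scalars: "ip x y \<in> S"
    and ip_add_left: "ip (x + y) z = ip x z + ip y z"
    and ip_smul_left: "a \<in> S \<Longrightarrow> ip (smul a x) y = a * ip x y"
    and ip_commute: "ip y x = cnj (ip x y)"
    and ip_norm: "ip x x = of_real ((norm x)\<^sup>2)"

lemma hilbert_space_real:
  "hilbert_space \<real> (\<lambda>c x. Re c *\<^sub>R x) (\<lambda>x y :: 'v::{real_inner, banach}. of_real (x \<bullet> y))"
  by unfold_locales
    (auto simp: Reals_def scaleR_add_left scaleR_add_right inner_add_left power2_norm_eq_inner
      simp flip: of_real_power intro: inner_commute)

lemma hilbert_space_complex: "hilbert_space UNIV (*) (\<lambda>x y :: complex. x * cnj y)"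
  by unfold_locales
    (auto simp: algebra_simps scaleR_conv_of_real simp flip: complex_norm_square)

definition closed_subspace :: "complex set \<Rightarrow> (complex \<Rightarrow> 'v::banach \<Rightarrow> 'v) \<Rightarrow> 'v set \<Rightarrow> bool" where
  "closed_subspace S smul V \<longleftrightarrow>
     closed V \<and> subspace V \<and> (\<forall>c\<in>S. \<forall>x\<in>V. smul c x \<in> V)"

text \<open>The space \<open>L(H, V)\<close> for a subspace \<open>V\<close> of the Hilbert space on \<open>'w\<close>.\<close>

definition bounded_operators ::
  "complex set \<Rightarrow> (complex \<Rightarrow> 'v::banach \<Rightarrow> 'v) \<Rightarrow> (complex \<Rightarrow> 'w::banach \<Rightarrow> 'w) \<Rightarrow> 'w set \<Rightarrow> ('v \<Rightarrow> 'w) set"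
  where "bounded_operators S smulH smulK V =
     {T. bounded_linear T \<and> (\<forall>c\<in>S. \<forall>x. T (smulH c x) = smulK c (T x)) \<and> range T \<subseteq> V}"

text \<open>
  The library constant \<^const>\<open>adjoint\<close> is tied to the real inner product of a type class.
  The codomain is not a parameter: if \<open>T\<close> maps into a subspace \<open>V\<close>, then the
  adjoint of \<open>T\<close> as an operator into \<open>V\<close> is the function below on the elements of \<open>V\<close>.
\<close>

definition hilbert_adjoint ::
  "('v \<Rightarrow> 'v \<Rightarrow> complex) \<Rightarrow> ('w \<Rightarrow> 'w \<Rightarrow> complex) \<Rightarrow> ('v \<Rightarrow> 'w) \<Rightarrow> 'w \<Rightarrow> 'v" where
  "hilbert_adjoint ipH ipK T g = (THE h. \<forall>f. ipK (T f) g = ipH f h)"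

text \<open>
  Summability is stated explicitly because \<^const>\<open>infsum\<close> is zero on families that are not summable.
\<close>

definition g_frame :: "'x set \<Rightarrow> ('x \<Rightarrow> 'v::banach \<Rightarrow> 'w::banach) \<Rightarrow> real \<Rightarrow> real \<Rightarrow> bool" where
  "g_frame X T A B \<longleftrightarrow> A > 0 \<and> B > 0 \<and>
     (\<forall>f. (\<lambda>x. (norm (T x f))\<^sup>2) summable_on X \<and>
          A * (norm f)\<^sup>2 \<le> (\<Sum>\<^sub>\<infinity>x\<in>X. (norm (T x f))\<^sup>2) \<and>
          (\<Sum>\<^sub>\<infinity>x\<in>X. (norm (T x f))\<^sup>2) \<le> B * (norm f)\<^sup>2)"

definition indexed_partition :: "nat \<Rightarrow> (nat \<Rightarrow> 'i set) \<Rightarrow> 'i set \<Rightarrow> bool" where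
  "indexed_partition m \<sigma> I \<longleftrightarrow> disjoint_family_on \<sigma> {1..m} \<and> (\<Union>j\<in>{1..m}. \<sigma> j) = I"

end

theory Submission
  imports Defs
begin

text \<open>
  Let \<open>\<rho>\<^sub>j = \<sigma>\<^bsub>j+1\<^esub> \<union> \<dots> \<union> \<sigma>\<^sub>m\<close>. Telescoping in \<open>j\<close>, the sum of \<open>\<parallel>\<Lambda>\<^sub>i\<^sub>1 f\<parallel>\<^sup>2\<close> over \<open>I\<close> exceeds the
  woven sum by the sums of \<open>\<parallel>\<Lambda>\<^sub>i\<^sub>j f\<parallel>\<^sup>2 - \<parallel>\<Lambda>\<^bsub>i(j+1)\<^esub> f\<parallel>\<^sup>2\<close> over \<open>\<rho>\<^sub>j\<close>. Each of these is at most
  \<open>\<parallel>x - y\<parallel> (\<parallel>x\<parallel> + \<parallel>y\<parallel>)\<close> for the coefficient families \<open>x\<close>, \<open>y\<close> of \<open>f\<close> in \<open>\<ell>\<^sup>2\<close>, and testing the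
  perturbation hypothesis on \<open>g = x - y\<close> bounds \<open>\<parallel>x - y\<parallel>\<close> by a multiple of \<open>\<parallel>f\<parallel>\<close>. Only finite
  subsets of \<open>I\<close> are needed, since all the sums have nonnegative terms.
\<close>

section \<open>Real parts of inner products and Riesz representation\<close>

context hilbert_space
begin

lemma Re_ip_commute: "Re (ip x y) = Re (ip y x)"
  by (metis cnj.simps(1) ip_commute)

lemma ip_diff_left: "ip (x - y) z = ip x z - ip y z"
  using ip_add_left[of "x - y" y z] by simp

lemma ip_scaleR_left: "ip (r *\<^sub>R x) y = of_real r * ip x y"
  using ip_smul_left[of "of_real r" x y] scalars by (auto simp: smul_of_real)

lemma norm_add_squared: "(norm (x + y))\<^sup>2 = (norm x)\<^sup>2 + (norm y)\<^sup>2 + 2 * Re (ip x y)"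
proof -
  have norm_eq: "(norm z)\<^sup>2 = Re (ip z z)" for z
    by (simp add: ip_norm)
  have "Re (ip z (x + y)) = Re (ip z x) + Re (ip z y)" for z
    using ip_add_left[of x y z] by (simp add: Re_ip_commute[of z])
  then show ?thesis
    by (simp add: norm_eq ip_add_left Re_ip_commute[of y x])
qed

text \<open>Cauchy-Schwarz is read off from the triangle inequality, which the normed type supplies,
  by expanding the squared norm of \<open>x + y\<close>.\<close>

lemma Re_ip_le: "Re (ip x y) \<le> norm x * norm y"
proof -
  have "(norm (x + y))\<^sup>2 \<le> (norm x + norm y)\<^sup>2"
    by (simp add: norm_triangle_ineq power_mono)
  then show ?thesis
    by (simp add: norm_add_squared power2_sum)
qed

text \<open>Real parts treat both scalar fields as one real inner product and open the library rules
  for sums, differences and bounded linearity.\<close>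

lemma bounded_bilinear_Re_ip: "bounded_bilinear (\<lambda>x y. Re (ip x y))"
proof
  show "Re (ip (x + y) z) = Re (ip x z) + Re (ip y z)" for x y z
    by (simp add: ip_add_left)
  then show "Re (ip z (x + y)) = Re (ip z x) + Re (ip z y)" for x y z
    by (simp add: Re_ip_commute[of z])
  show "Re (ip (r *\<^sub>R x) y) = r *\<^sub>R Re (ip x y)" for r x y
    by (simp add: ip_scaleR_left)
  then show "Re (ip x (r *\<^sub>R y)) = r *\<^sub>R Re (ip x y)" for r x y
    by (simp add: Re_ip_commute[of x])
  have "- Re (ip x y) \<le> norm x * norm y" for x y
    using Re_ip_le[of "(-1) *\<^sub>R x" y] unfolding ip_scaleR_left by simp
  then have "\<bar>Re (ip x y)\<bar> \<le> norm x * norm y" for x y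
    using Re_ip_le[of x y] by (simp add: abs_le_iff)
  then show "\<exists>C. \<forall>x y. norm (Re (ip x y)) \<le> norm x * norm y * C"
    by (intro exI[of _ 1]) simp
qed

lemma parallelogram:
  fixes x y :: 'v
  shows "(norm (x + y))\<^sup>2 + (norm (x - y))\<^sup>2 = 2 * (norm x)\<^sup>2 + 2 * (norm y)\<^sup>2"
  using norm_add_squared[of x y] norm_add_squared[of x "-y"]
    bounded_bilinear.minus_right[OF bounded_bilinear_Re_ip, of x y]
  by simp

text \<open>The representing vector minimises \<open>\<parallel>x\<parallel>\<^sup>2 - 2 \<phi> x\<close>.\<close>

lemma real_riesz_exists:
  assumes "bounded_linear \<phi>"
  shows "\<exists>h. \<forall>x. \<phi> x = Re (ip x h)"
proof -
  interpret \<phi>: bounded_linear \<phi> by fact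
  define Q where "Q x = (norm x)\<^sup>2 - 2 * \<phi> x" for x
  obtain C where C: "\<And>x. norm (\<phi> x) \<le> norm x * C"
    using \<phi>.bounded by blast
  \<comment> \<open>Since \<open>\<phi> x\<close> is at most \<open>norm x * C\<close>, completing
    the square in \<open>norm x\<close> bounds \<open>Q\<close> below.\<close>
  have "- C\<^sup>2 \<le> Q x" for x
  proof -
    have "0 \<le> (norm x - C)\<^sup>2" by simp
    with C[of x] show ?thesis by (simp add: Q_def power2_diff algebra_simps)
  qed
  then have bdd: "bdd_below (range Q)"
    by (intro bdd_belowI2)
  define q where "q = Inf (range Q)"
  have q_le: "q \<le> Q x" for x
    unfolding q_def using bdd by (simp add: cInf_lower)
  have "\<exists>x. Q x < q + inverse (real (Suc n))" for n
    using cInf_lessD[of "range Q" "q + inverse (real (Suc n))"]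
    by (auto simp: q_def simp del: of_nat_Suc)
  then obtain X where X: "\<And>n. Q (X n) < q + inverse (real (Suc n))"
    by metis
  \<comment> \<open>The linear terms cancel in the parallelogram law. As \<open>Q\<close> at the
    midpoint is at least \<open>q\<close>, near-minimisers must be close together.\<close>
  have half: "(norm (x - y))\<^sup>2 = 2 * Q x + 2 * Q y - 4 * Q ((1/2) *\<^sub>R (x + y))" for x y
    using parallelogram[of x y]
    by (simp add: Q_def \<phi>.scaleR \<phi>.add power_divide algebra_simps flip: scaleR_add_right)
  have close: "(norm (X k - X n))\<^sup>2 < 4 * inverse (real (Suc N))" if "k \<ge> N" "n \<ge> N" for k n N
  proof -
    have "inverse (real (Suc k)) \<le> inverse (real (Suc N))"
      and "inverse (real (Suc n)) \<le> inverse (real (Suc N))"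
      using that by (auto simp: field_simps)
    with X[of k] X[of n] q_le[of "(1/2) *\<^sub>R (X k + X n)"] show ?thesis
      unfolding half by linarith
  qed
  have "Cauchy X"
  proof (rule CauchyI)
    fix e :: real assume "e > 0"
    then obtain N where N: "inverse (real (Suc N)) < e\<^sup>2 / 4"
      using reals_Archimedean[of "e\<^sup>2 / 4"] by auto
    have "norm (X k - X n) < e" if "k \<ge> N" "n \<ge> N" for k n
    proof -
      have "(norm (X k - X n))\<^sup>2 < e\<^sup>2"
        using close[OF that] N by linarith
      then show ?thesis
        using \<open>e > 0\<close> by (simp add: power_less_imp_less_base)
    qed
    then show "\<exists>N. \<forall>k\<ge>N. \<forall>n\<ge>N. norm (X k - X n) < e"
      by blast
  qed
  then obtain h where "X \<longlonglongrightarrow> h"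
    using Cauchy_convergent convergent_def by blast
  then have "(\<lambda>n. Q (X n)) \<longlonglongrightarrow> Q h"
    unfolding Q_def by (intro tendsto_intros \<phi>.tendsto)
  moreover have "(\<lambda>n. q + inverse (real (Suc n))) \<longlonglongrightarrow> q"
    using LIMSEQ_inverse_real_of_nat_add[of q] by simp
  ultimately have Q_h: "Q h \<le> q"
    using X by (meson LIMSEQ_le less_imp_le)
  have "\<phi> x = Re (ip x h)" for x
  proof (rule ccontr)
    define d where "d = \<phi> x - Re (ip x h)"
    assume "\<phi> x \<noteq> Re (ip x h)"
    then have "d \<noteq> 0" by (simp add: d_def)
    \<comment> \<open>The change of \<open>Q\<close> along \<open>x\<close> is least at
      \<open>d / (norm x)\<^sup>2\<close>; the extra 1 keeps the denominator positive for
      \<open>x = 0\<close>, and the step still takes \<open>Q\<close> below its minimum.\<close>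
    define t where "t = d / ((norm x)\<^sup>2 + 1)"
    have "Q (t *\<^sub>R x + h) = Q h + t\<^sup>2 * (norm x)\<^sup>2 - 2 * t * d"
      unfolding Q_def d_def norm_add_squared \<phi>.add \<phi>.scaleR ip_scaleR_left
      by (simp add: power_mult_distrib algebra_simps)
    then have "2 * t * d \<le> t\<^sup>2 * (norm x)\<^sup>2"
      using Q_h q_le[of "t *\<^sub>R x + h"] by simp
    moreover have "d = t * ((norm x)\<^sup>2 + 1)"
      by (simp add: t_def add_nonneg_eq_0_iff)
    ultimately have "t\<^sup>2 * ((norm x)\<^sup>2 + 2) \<le> 0"
      by (simp add: power2_eq_square algebra_simps)
    moreover have "t \<noteq> 0"
      using \<open>d \<noteq> 0\<close> by (simp add: t_def add_nonneg_eq_0_iff)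
    then have "t\<^sup>2 * ((norm x)\<^sup>2 + 2) > 0"
      by (simp add: add_nonneg_pos)
    ultimately show False by simp
  qed
  then show ?thesis by blast
qed

text \<open>Tested with \<open>f = h - h'\<close>; this supplies the uniqueness of the
  adjoint.\<close>

lemma ip_right_cancel:
  assumes "\<And>f. ip f h = ip f h'"
  shows "h = h'"
proof -
  have "Re (ip (h - h') (h - h')) = 0"
    using assms by (simp add: bounded_bilinear.diff_right[OF bounded_bilinear_Re_ip])
  then show ?thesis by (simp add: ip_norm)
qed

end

section \<open>Adjoints and finite synthesis sums\<close>

text \<open>Justifies the definite description in \<open>hilbert_adjoint\<close>: Riesz gives a
  vector with the right real parts, the scalar field recovers the full identity, and
  \<open>ip_right_cancel\<close> gives uniqueness.\<close>

lemma ip_hilbert_adjoint: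
  assumes H: "hilbert_space S smulH ipH" and K: "hilbert_space S smulK ipK"
    and T: "T \<in> bounded_operators S smulH smulK V"
  shows "ipK (T f) g = ipH f (hilbert_adjoint ipH ipK T g)"
proof -
  interpret H: hilbert_space S smulH ipH by fact
  interpret K: hilbert_space S smulK ipK by fact
  have T_lin: "bounded_linear T" and T_smul: "\<And>c x. c \<in> S \<Longrightarrow> T (smulH c x) = smulK c (T x)"
    using T by (auto simp: bounded_operators_def)
  have "bounded_linear (\<lambda>f. Re (ipK (T f) g))"
    using bounded_linear_compose[OF bounded_bilinear.bounded_linear_left[OF K.bounded_bilinear_Re_ip] T_lin] .
  then obtain h where h: "\<And>f. Re (ipK (T f) g) = Re (ipH f h)"
    using H.real_riesz_exists by blast
  have "ipK (T f) g = ipH f h" for f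
  proof (cases "S = UNIV")
    case True
    \<comment> \<open>Real parts at \<open>smulH \<i> f\<close> yield imaginary parts at
      \<open>f\<close>, because \<open>Re (\<i> * z) = - Im z\<close>.\<close>
    then have "Re (\<i> * ipK (T f) g) = Re (\<i> * ipH f h)"
      using h[of "smulH \<i> f"] T_smul by (simp add: H.ip_smul_left K.ip_smul_left)
    with h show ?thesis by (simp add: complex_eq_iff)
  next
    case False
    then have "S = \<real>" using H.scalars by blast
    with H.ip_in_scalars[of f h] K.ip_in_scalars[of "T f" g] h show ?thesis
      by (auto simp: complex_eq_iff complex_is_Real_iff)
  qed
  then have "\<exists>!h. \<forall>f. ipK (T f) g = ipH f h"
    using H.ip_right_cancel by metis
  from theI'[OF this] show ?thesis
    unfolding hilbert_adjoint_def by blast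
qed

text \<open>Exhibits the synthesis sum as the adjoint of the analysis map sending \<open>f\<close>
  to the finite family of \<open>T i f\<close>.\<close>

lemma Re_ip_sum_adjoint:
  assumes H: "hilbert_space S smulH ipH" and K: "hilbert_space S smulK ipK"
    and T: "\<And>i. i \<in> J \<Longrightarrow> T i \<in> bounded_operators S smulH smulK (V i)"
  shows "Re (ipH f (\<Sum>i\<in>J. hilbert_adjoint ipH ipK (T i) (g i))) = (\<Sum>i\<in>J. Re (ipK (T i f) (g i)))"
  by (simp add: bounded_bilinear.sum_right[OF hilbert_space.bounded_bilinear_Re_ip[OF H]]
      ip_hilbert_adjoint[OF H K T])

text \<open>Pairing the sum \<open>h\<close> with itself moves the adjoints onto
  \<open>T i h\<close>; Cauchy-Schwarz and the Bessel bound leave one factor \<open>norm h\<close>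
  to cancel, hence the separate case of a vanishing sum.\<close>

lemma norm_sum_adjoint_le:
  assumes H: "hilbert_space S smulH ipH" and K: "hilbert_space S smulK ipK"
    and T: "\<And>i. i \<in> J \<Longrightarrow> T i \<in> bounded_operators S smulH smulK (V i)"
    and "C \<ge> 0" and bessel: "\<And>f. L2_set (\<lambda>i. norm (T i f)) J \<le> C * norm f"
  shows "norm (\<Sum>i\<in>J. hilbert_adjoint ipH ipK (T i) (g i)) \<le> C * L2_set (\<lambda>i. norm (g i)) J"
proof (cases "(\<Sum>i\<in>J. hilbert_adjoint ipH ipK (T i) (g i)) = 0")
  case True
  with \<open>C \<ge> 0\<close> show ?thesis by (simp add: L2_set_nonneg)
next
  case False
  interpret K: hilbert_space S smulK ipK by fact
  interpret H: hilbert_space S smulH ipH by fact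
  define h where "h = (\<Sum>i\<in>J. hilbert_adjoint ipH ipK (T i) (g i))"
  have "(norm h)\<^sup>2 = Re (ipH h h)"
    by (simp add: H.ip_norm)
  also have "\<dots> = (\<Sum>i\<in>J. Re (ipK (T i h) (g i)))"
    using Re_ip_sum_adjoint[OF H K T, where f = h and g = g] by (simp add: h_def)
  also have "\<dots> \<le> (\<Sum>i\<in>J. \<bar>norm (T i h)\<bar> * \<bar>norm (g i)\<bar>)"
    by (intro sum_mono) (simp add: K.Re_ip_le)
  also have "\<dots> \<le> L2_set (\<lambda>i. norm (T i h)) J * L2_set (\<lambda>i. norm (g i)) J"
    by (rule L2_set_mult_ineq)
  also have "\<dots> \<le> C * norm h * L2_set (\<lambda>i. norm (g i)) J"
    by (intro mult_right_mono bessel L2_set_nonneg)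
  finally show ?thesis
    using False by (simp add: h_def[symmetric] power2_eq_square mult.commute mult.left_commute)
qed

section \<open>From perturbed adjoints to perturbed coefficients\<close>

text \<open>For \<open>g i = T i f - U i f\<close> with l2 norm \<open>G\<close>, the difference
  \<open>t - u\<close> of the synthesis sums pairs with \<open>f\<close> to
  \<open>G\<^sup>2\<close>. The hypothesis and the two Bessel bounds make
  \<open>norm (t - u)\<close> at most a multiple of \<open>G\<close>, so one factor \<open>G\<close>
  cancels.\<close>

lemma L2_difference_le_of_perturbation:
  assumes H: "hilbert_space S smulH ipH" and K: "hilbert_space S smulK ipK"
    and T: "\<And>i. i \<in> J \<Longrightarrow> T i \<in> bounded_operators S smulH smulK (V i)"
    and U: "\<And>i. i \<in> J \<Longrightarrow> U i \<in> bounded_operators S smulH smulK (V i)"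
    and V: "\<And>i. i \<in> J \<Longrightarrow> subspace (V i)"
    and nonneg: "C \<ge> 0" "D \<ge> 0" "\<eta> \<ge> 0" "\<mu> \<ge> 0" "l \<ge> 0"
    and T_bessel: "\<And>f. L2_set (\<lambda>i. norm (T i f)) J \<le> C * norm f"
    and U_bessel: "\<And>f. L2_set (\<lambda>i. norm (U i f)) J \<le> D * norm f"
    and perturbation: "\<And>g. (\<And>i. i \<in> J \<Longrightarrow> g i \<in> V i) \<Longrightarrow>
      norm (\<Sum>i\<in>J. hilbert_adjoint ipH ipK (T i) (g i) - hilbert_adjoint ipH ipK (U i) (g i))
        \<le> \<eta> * norm (\<Sum>i\<in>J. hilbert_adjoint ipH ipK (T i) (g i))
          + \<mu> * norm (\<Sum>i\<in>J. hilbert_adjoint ipH ipK (U i) (g i))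
          + l * L2_set (\<lambda>i. norm (g i)) J"
  shows "L2_set (\<lambda>i. norm (T i f - U i f)) J \<le> (l + \<eta> * C + \<mu> * D) * norm f"
proof -
  interpret H: hilbert_space S smulH ipH by fact
  interpret K: hilbert_space S smulK ipK by fact
  define g where "g i = T i f - U i f" for i
  define G where "G = L2_set (\<lambda>i. norm (g i)) J"
  define t where "t = (\<Sum>i\<in>J. hilbert_adjoint ipH ipK (T i) (g i))"
  define u where "u = (\<Sum>i\<in>J. hilbert_adjoint ipH ipK (U i) (g i))"
  \<comment> \<open>\<open>g\<close> is admissible in the hypothesis because both operators map into
    the same subspace.\<close>
  have "g i \<in> V i" if "i \<in> J" for i
    using T[OF that] U[OF that] V[OF that]
    by (auto simp: g_def bounded_operators_def intro!: subspace_diff)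
  then have "norm (t - u) \<le> \<eta> * norm t + \<mu> * norm u + l * G"
    using perturbation[of g] by (simp add: t_def u_def G_def sum_subtractf)
  moreover have "norm t \<le> C * G" and "norm u \<le> D * G"
    using norm_sum_adjoint_le[OF H K T nonneg(1) T_bessel, of g]
      norm_sum_adjoint_le[OF H K U nonneg(2) U_bessel, of g]
    by (simp_all add: t_def u_def G_def)
  then have "\<eta> * norm t \<le> \<eta> * (C * G)" and "\<mu> * norm u \<le> \<mu> * (D * G)"
    using nonneg by (simp_all add: mult_left_mono)
  ultimately have le: "norm (t - u) \<le> (l + \<eta> * C + \<mu> * D) * G"
    by (simp add: algebra_simps)
  have "G\<^sup>2 = (\<Sum>i\<in>J. (norm (g i))\<^sup>2)"
    by (simp add: G_def L2_set_def sum_nonneg)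
  also have "\<dots> = (\<Sum>i\<in>J. Re (ipK (T i f) (g i)) - Re (ipK (U i f) (g i)))"
  proof (rule sum.cong)
    fix i
    have "(norm (g i))\<^sup>2 = Re (ipK (g i) (g i))"
      by (simp add: K.ip_norm)
    also have "\<dots> = Re (ipK (T i f - U i f) (g i))"
      by (simp only: g_def)
    finally show "(norm (g i))\<^sup>2 = Re (ipK (T i f) (g i)) - Re (ipK (U i f) (g i))"
      by (simp add: K.ip_diff_left)
  qed simp
  also have "\<dots> = Re (ipH f (t - u))"
    unfolding t_def u_def bounded_bilinear.diff_right[OF H.bounded_bilinear_Re_ip]
    by (simp add: Re_ip_sum_adjoint[OF H K T] Re_ip_sum_adjoint[OF H K U] sum_subtractf)
  also have "\<dots> \<le> norm f * norm (t - u)"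
    by (rule H.Re_ip_le)
  also have "\<dots> \<le> norm f * ((l + \<eta> * C + \<mu> * D) * G)"
    using le by (rule mult_left_mono) simp
  finally have "G * G \<le> G * ((l + \<eta> * C + \<mu> * D) * norm f)"
    by (simp add: power2_eq_square mult_ac)
  moreover have "G \<ge> 0"
    by (simp add: G_def L2_set_nonneg)
  ultimately have "G \<le> (l + \<eta> * C + \<mu> * D) * norm f"
    using nonneg by (cases "G = 0") auto
  then show ?thesis by (simp add: G_def g_def)
qed

section \<open>Finite sums of squared coefficients\<close>

text \<open>Each term factors into a difference and a sum of norms; the reverse triangle inequality,
  Cauchy-Schwarz and the triangle inequality in l2 finish.\<close>

lemma sum_norm_squared_diff_le:
  fixes x y :: "'i \<Rightarrow> 'v::real_normed_vector"
  shows "(\<Sum>i\<in>J. (norm (x i))\<^sup>2 - (norm (y i))\<^sup>2)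
    \<le> L2_set (\<lambda>i. norm (x i - y i)) J * (L2_set (\<lambda>i. norm (x i)) J + L2_set (\<lambda>i. norm (y i)) J)"
proof -
  have "(\<Sum>i\<in>J. (norm (x i))\<^sup>2 - (norm (y i))\<^sup>2)
      \<le> (\<Sum>i\<in>J. \<bar>norm (x i - y i)\<bar> * \<bar>norm (x i) + norm (y i)\<bar>)"
  proof (rule sum_mono)
    fix i
    have "(norm (x i))\<^sup>2 - (norm (y i))\<^sup>2 = (norm (x i) - norm (y i)) * (norm (x i) + norm (y i))"
      by (simp add: power2_eq_square algebra_simps)
    also have "\<dots> \<le> norm (x i - y i) * (norm (x i) + norm (y i))"
      by (intro mult_right_mono norm_triangle_ineq2) simp
    finally show "(norm (x i))\<^sup>2 - (norm (y i))\<^sup>2 \<le> \<bar>norm (x i - y i)\<bar> * \<bar>norm (x i) + norm (y i)\<bar>"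
      by simp
  qed
  also have "\<dots> \<le> L2_set (\<lambda>i. norm (x i - y i)) J * L2_set (\<lambda>i. norm (x i) + norm (y i)) J"
    by (rule L2_set_mult_ineq)
  also have "\<dots> \<le> L2_set (\<lambda>i. norm (x i - y i)) J
      * (L2_set (\<lambda>i. norm (x i)) J + L2_set (\<lambda>i. norm (y i)) J)"
    by (intro mult_left_mono L2_set_triangle_ineq L2_set_nonneg)
  finally show ?thesis .
qed

lemma g_frame_finite_sum_le:
  assumes "g_frame X T A B" "finite J" "J \<subseteq> X"
  shows "(\<Sum>x\<in>J. (norm (T x f))\<^sup>2) \<le> B * (norm f)\<^sup>2"
proof -
  have "(\<Sum>x\<in>J. (norm (T x f))\<^sup>2) \<le> (\<Sum>\<^sub>\<infinity>x\<in>X. (norm (T x f))\<^sup>2)"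
    using assms by (intro finite_sum_le_infsum) (auto simp: g_frame_def)
  also have "\<dots> \<le> B * (norm f)\<^sup>2"
    using assms by (simp add: g_frame_def)
  finally show ?thesis .
qed

lemma g_frame_finite_L2_set_le:
  assumes "g_frame X T A B" "finite J" "J \<subseteq> X"
  shows "L2_set (\<lambda>x. norm (T x f)) J \<le> sqrt B * norm f"
proof -
  have "L2_set (\<lambda>x. norm (T x f)) J \<le> sqrt (B * (norm f)\<^sup>2)"
    unfolding L2_set_def by (rule real_sqrt_le_mono) (rule g_frame_finite_sum_le[OF assms])
  then show ?thesis by (simp add: real_sqrt_mult)
qed

text \<open>Each \<open>i\<close> telescopes from 1 up to its own \<open>\<kappa> i\<close>, passing
  exactly the steps \<open>j < \<kappa> i\<close>; exchanging the sums collects the indices by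
  step.\<close>

lemma sum_telescope_selection:
  fixes u :: "'i \<Rightarrow> nat \<Rightarrow> real"
  assumes "\<And>i. i \<in> F \<Longrightarrow> \<kappa> i \<in> {1..m}" "finite F"
  shows "(\<Sum>i\<in>F. u i 1) = (\<Sum>i\<in>F. u i (\<kappa> i))
    + (\<Sum>j\<in>{1..m-1}. \<Sum>i\<in>{i\<in>F. j < \<kappa> i}. u i j - u i (j + 1))"
proof -
  have "u i 1 = u i (\<kappa> i) + (\<Sum>j\<in>{1..m-1}. if j < \<kappa> i then u i j - u i (j + 1) else 0)"
    if "i \<in> F" for i
  proof -
    \<comment> \<open>Because \<open>\<kappa> i \<le> m\<close>, the cutoff at \<open>m-1\<close>
      loses no step below \<open>\<kappa> i\<close>.\<close>
    have "{j \<in> {1..m-1}. j < \<kappa> i} = {1..<\<kappa> i}"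
      using assms(1)[OF that] by auto
    then have "(\<Sum>j\<in>{1..m-1}. if j < \<kappa> i then u i j - u i (j + 1) else 0)
        = (\<Sum>j\<in>{1..<\<kappa> i}. u i j - u i (j + 1))"
      by (simp add: sum.inter_filter[symmetric])
    also have "\<dots> = - (\<Sum>j\<in>{1..<\<kappa> i}. u i (Suc j) - u i j)"
      by (simp flip: sum_negf)
    also have "\<dots> = u i 1 - u i (\<kappa> i)"
      using assms(1)[OF that] by (subst sum_Suc_diff') auto
    finally show ?thesis by simp
  qed
  then have "(\<Sum>i\<in>F. u i 1) = (\<Sum>i\<in>F. u i (\<kappa> i))
      + (\<Sum>i\<in>F. \<Sum>j\<in>{1..m-1}. if j < \<kappa> i then u i j - u i (j + 1) else 0)"
    by (simp flip: sum.distrib)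
  also have "(\<Sum>i\<in>F. \<Sum>j\<in>{1..m-1}. if j < \<kappa> i then u i j - u i (j + 1) else 0)
      = (\<Sum>j\<in>{1..m-1}. \<Sum>i\<in>F. if j < \<kappa> i then u i j - u i (j + 1) else 0)"
    by (rule sum.swap)
  also have "\<dots> = (\<Sum>j\<in>{1..m-1}. \<Sum>i\<in>{i\<in>F. j < \<kappa> i}. u i j - u i (j + 1))"
    by (simp only: sum.inter_filter[OF assms(2)])
  finally show ?thesis .
qed

section \<open>Bounds for the woven families\<close>

theorem theorem5p2:
  fixes S :: "complex set"
    and smulH :: "complex \<Rightarrow> 'h::banach \<Rightarrow> 'h" and ipH :: "'h \<Rightarrow> 'h \<Rightarrow> complex"
    and smulK :: "complex \<Rightarrow> 'k::banach \<Rightarrow> 'k" and ipK :: "'k \<Rightarrow> 'k \<Rightarrow> complex"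
    and I :: "nat set" and m :: nat
    and V :: "nat \<Rightarrow> 'k set"
    and \<Lambda> :: "nat \<Rightarrow> nat \<Rightarrow> 'h \<Rightarrow> 'k"
    and a b l \<eta> \<mu> :: "nat \<Rightarrow> real" and A :: real
  assumes H: "hilbert_space S smulH ipH"
    and K: "hilbert_space S smulK ipK"
    and V: "\<And>i. i \<in> I \<Longrightarrow> closed_subspace S smulK (V i)"
    and m: "m \<ge> 1"
    and \<Lambda>: "\<And>i j. \<lbrakk>i \<in> I; j \<in> {1..m}\<rbrakk> \<Longrightarrow> \<Lambda> i j \<in> bounded_operators S smulH smulK (V i)"
    and frames: "\<And>j. j \<in> {1..m} \<Longrightarrow> g_frame I (\<lambda>i. \<Lambda> i j) (a j) (b j)"
    and nonneg: "\<And>j. j \<in> {1..m-1} \<Longrightarrow> l j \<ge> 0 \<and> \<eta> j \<ge> 0 \<and> \<mu> j \<ge> 0"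
    and A: "A = a 1 - (\<Sum>j\<in>{1..m-1}. (l j + \<eta> j * sqrt (b j) + \<mu> j * sqrt (b (j + 1)))
                                   * (sqrt (b j) + sqrt (b (j + 1))))"
    and A_pos: "A > 0"
    and perturbation:
      "\<And>J g j. \<lbrakk>finite J; J \<subseteq> I; \<And>i. i \<in> J \<Longrightarrow> g i \<in> V i; j \<in> {1..m-1}\<rbrakk> \<Longrightarrow>
         norm (\<Sum>i\<in>J. hilbert_adjoint ipH ipK (\<Lambda> i j) (g i)
                      - hilbert_adjoint ipH ipK (\<Lambda> i (j + 1)) (g i))
         \<le> \<eta> j * norm (\<Sum>i\<in>J. hilbert_adjoint ipH ipK (\<Lambda> i j) (g i))
           + \<mu> j * norm (\<Sum>i\<in>J. hilbert_adjoint ipH ipK (\<Lambda> i (j + 1)) (g i))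
           + l j * sqrt (\<Sum>i\<in>J. (norm (g i))\<^sup>2)"
  shows "\<forall>\<sigma>. indexed_partition m \<sigma> I \<longrightarrow>
           g_frame (SIGMA j:{1..m}. \<sigma> j) (\<lambda>(j, i). \<Lambda> i j) A (\<Sum>j\<in>{1..m}. b j)"
proof (intro allI impI)
  fix \<sigma> assume \<sigma>: "indexed_partition m \<sigma> I"
  let ?X = "SIGMA j:{1..m}. \<sigma> j"
  \<comment> \<open>The loss at step \<open>j\<close>, which is the summand subtracted from
    \<open>a 1\<close> in \<open>A\<close>.\<close>
  define r where "r j = (l j + \<eta> j * sqrt (b j) + \<mu> j * sqrt (b (j + 1)))
    * (sqrt (b j) + sqrt (b (j + 1)))" for j
  have b_pos: "b j > 0" if "j \<in> {1..m}" for j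
    using frames[OF that] by (simp add: g_frame_def)
  \<comment> \<open>The first factor of \<open>r j\<close> comes from the perturbed difference, the
    second from the two Bessel bounds.\<close>
  have step: "(\<Sum>i\<in>J. (norm (\<Lambda> i j f))\<^sup>2 - (norm (\<Lambda> i (j + 1) f))\<^sup>2) \<le> r j * (norm f)\<^sup>2"
    if J: "finite J" "J \<subseteq> I" and j: "j \<in> {1..m-1}" for J j f
  proof -
    have j': "j \<in> {1..m}" "j + 1 \<in> {1..m}"
      using j by auto
    note bessel = g_frame_finite_L2_set_le[OF frames[OF j'(1)] J]
      g_frame_finite_L2_set_le[OF frames[OF j'(2)] J]
    define c where "c = (l j + \<eta> j * sqrt (b j) + \<mu> j * sqrt (b (j + 1))) * norm f"
    have "L2_set (\<lambda>i. norm (\<Lambda> i j f - \<Lambda> i (j + 1) f)) J \<le> c"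
      unfolding c_def
    proof (rule L2_difference_le_of_perturbation[OF H K, where V = V])
      show "\<Lambda> i j \<in> bounded_operators S smulH smulK (V i)"
        and "\<Lambda> i (j + 1) \<in> bounded_operators S smulH smulK (V i)" if "i \<in> J" for i
        using \<Lambda> j' J that by auto
      show "subspace (V i)" if "i \<in> J" for i
        using V J that by (auto simp: closed_subspace_def)
      show "norm (\<Sum>i\<in>J. hilbert_adjoint ipH ipK (\<Lambda> i j) (g i)
              - hilbert_adjoint ipH ipK (\<Lambda> i (j + 1)) (g i))
          \<le> \<eta> j * norm (\<Sum>i\<in>J. hilbert_adjoint ipH ipK (\<Lambda> i j) (g i))
            + \<mu> j * norm (\<Sum>i\<in>J. hilbert_adjoint ipH ipK (\<Lambda> i (j + 1)) (g i))
            + l j * L2_set (\<lambda>i. norm (g i)) J"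
        if "\<And>i. i \<in> J \<Longrightarrow> g i \<in> V i" for g
        using perturbation[OF J that j] by (simp add: L2_set_def)
    qed (use bessel nonneg[OF j] b_pos j' in \<open>auto simp: less_imp_le\<close>)
    moreover have "c \<ge> 0"
      using nonneg[OF j] b_pos[OF j'(1)] b_pos[OF j'(2)] by (simp add: c_def)
    ultimately have "L2_set (\<lambda>i. norm (\<Lambda> i j f - \<Lambda> i (j + 1) f)) J
        * (L2_set (\<lambda>i. norm (\<Lambda> i j f)) J + L2_set (\<lambda>i. norm (\<Lambda> i (j + 1) f)) J)
      \<le> c * (sqrt (b j) * norm f + sqrt (b (j + 1)) * norm f)"
      by (intro mult_mono add_mono bessel add_nonneg_nonneg L2_set_nonneg)
    also have "\<dots> = r j * (norm f)\<^sup>2"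
      by (simp add: c_def r_def power2_eq_square algebra_simps)
    finally show ?thesis
      by (rule order_trans[OF sum_norm_squared_diff_le])
  qed
  have upper: "(\<Sum>(j, i)\<in>G. (norm (\<Lambda> i j f))\<^sup>2) \<le> (\<Sum>j\<in>{1..m}. b j) * (norm f)\<^sup>2"
    if G: "finite G" "G \<subseteq> ?X" for G f
  proof -
    have snd_G: "finite (snd ` G)" "snd ` G \<subseteq> I"
      using G \<sigma> by (fastforce simp: indexed_partition_def)+
    \<comment> \<open>Enlarging \<open>G\<close> to a rectangle adds only nonnegative terms and lets
      every frame be estimated on one finite subset of \<open>I\<close>, so that the bounds
      \<open>b j\<close> add up.\<close>
    have "G \<subseteq> {1..m} \<times> snd ` G"
      using G(2) by force
    then have "(\<Sum>(j, i)\<in>G. (norm (\<Lambda> i j f))\<^sup>2) \<le> (\<Sum>(j, i)\<in>{1..m} \<times> snd ` G. (norm (\<Lambda> i j f))\<^sup>2)"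
      using snd_G by (intro sum_mono2) auto
    also have "\<dots> = (\<Sum>j\<in>{1..m}. \<Sum>i\<in>snd ` G. (norm (\<Lambda> i j f))\<^sup>2)"
      by (rule sum.cartesian_product[symmetric])
    also have "\<dots> \<le> (\<Sum>j\<in>{1..m}. b j * (norm f)\<^sup>2)"
      by (intro sum_mono g_frame_finite_sum_le[OF frames snd_G])
    finally show ?thesis by (simp add: sum_distrib_right)
  qed
  \<comment> \<open>Secured before any infinite sum is estimated, since a family that is not
    summable would get the value 0.\<close>
  have summable: "(\<lambda>(j, i). (norm (\<Lambda> i j f))\<^sup>2) summable_on ?X" for f
  proof (rule nonneg_bdd_above_summable_on)
    show "bdd_above (sum (\<lambda>(j, i). (norm (\<Lambda> i j f))\<^sup>2) ` {G. G \<subseteq> ?X \<and> finite G})"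
      by (rule bdd_aboveI2[of _ _ "(\<Sum>j\<in>{1..m}. b j) * (norm f)\<^sup>2"]) (use upper in blast)
  qed auto
  have lower: "A * (norm f)\<^sup>2 \<le> (\<Sum>\<^sub>\<infinity>(j, i)\<in>?X. (norm (\<Lambda> i j f))\<^sup>2)" (is "_ \<le> ?W") for f
  proof -
    \<comment> \<open>The block number of \<open>i\<close>, available because the blocks cover
      \<open>I\<close>.\<close>
    obtain \<kappa> where \<kappa>: "\<And>i. i \<in> I \<Longrightarrow> \<kappa> i \<in> {1..m} \<and> i \<in> \<sigma> (\<kappa> i)"
      using \<sigma> unfolding indexed_partition_def by (metis UN_E)
    have "(\<Sum>i\<in>F. (norm (\<Lambda> i 1 f))\<^sup>2) \<le> ?W + (\<Sum>j\<in>{1..m-1}. r j) * (norm f)\<^sup>2"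
      if F: "finite F" "F \<subseteq> I" for F
    proof -
      \<comment> \<open>The map to pairs is injective through its second coordinate and lands in
        \<open>?X\<close>, so the selected sum is a finite partial sum of \<open>?W\<close>.\<close>
      have "(\<Sum>i\<in>F. (norm (\<Lambda> i (\<kappa> i) f))\<^sup>2) = (\<Sum>(j, i)\<in>(\<lambda>i. (\<kappa> i, i)) ` F. (norm (\<Lambda> i j f))\<^sup>2)"
        by (subst sum.reindex) (auto simp: inj_on_def)
      also have "\<dots> \<le> ?W"
        using F \<kappa> by (intro finite_sum_le_infsum summable) auto
      finally have selected: "(\<Sum>i\<in>F. (norm (\<Lambda> i (\<kappa> i) f))\<^sup>2) \<le> ?W" .
      \<comment> \<open>Here \<open>step\<close> is applied to the part of \<open>F\<close> in the
        blocks after \<open>j\<close>.\<close>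
      have "(\<Sum>j\<in>{1..m-1}. \<Sum>i\<in>{i\<in>F. j < \<kappa> i}. (norm (\<Lambda> i j f))\<^sup>2 - (norm (\<Lambda> i (j + 1) f))\<^sup>2)
          \<le> (\<Sum>j\<in>{1..m-1}. r j * (norm f)\<^sup>2)"
        using F by (intro sum_mono step) auto
      moreover have "\<kappa> i \<in> {1..m}" if "i \<in> F" for i
        using \<kappa> F(2) that by blast
      note sum_telescope_selection[OF this F(1), where u = "\<lambda>i j. (norm (\<Lambda> i j f))\<^sup>2"]
      ultimately show ?thesis
        using selected by (simp add: sum_distrib_right)
    qed
    \<comment> \<open>The bound is uniform in \<open>F\<close>, so it passes to the sum over
      \<open>I\<close>, where the lower frame bound \<open>a 1\<close> enters.\<close>
    then have "(\<Sum>\<^sub>\<infinity>i\<in>I. (norm (\<Lambda> i 1 f))\<^sup>2) \<le> ?W + (\<Sum>j\<in>{1..m-1}. r j) * (norm f)\<^sup>2"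
      using frames[of 1] m by (intro infsum_le_finite_sums) (auto simp: g_frame_def)
    moreover have "a 1 * (norm f)\<^sup>2 \<le> (\<Sum>\<^sub>\<infinity>i\<in>I. (norm (\<Lambda> i 1 f))\<^sup>2)"
      using frames[of 1] m by (auto simp: g_frame_def)
    ultimately show ?thesis
      by (simp add: A r_def left_diff_distrib)
  qed
  have "(\<Sum>\<^sub>\<infinity>(j, i)\<in>?X. (norm (\<Lambda> i j f))\<^sup>2) \<le> (\<Sum>j\<in>{1..m}. b j) * (norm f)\<^sup>2" for f
    by (rule infsum_le_finite_sums[OF summable upper])
  \<comment> \<open>\<open>m \<ge> 1\<close> makes the sum nonempty, hence strictly positive as
    \<open>g_frame\<close> demands.\<close>
  moreover have "(\<Sum>j\<in>{1..m}. b j) > 0"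
    using m b_pos by (intro sum_pos) auto
  ultimately show "g_frame ?X (\<lambda>(j, i). \<Lambda> i j) A (\<Sum>j\<in>{1..m}. b j)"
    using A_pos summable lower by (simp add: g_frame_def case_prod_unfold)
qed

end
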